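(* Let $S$ be an inverse semigroup and let $\mathscr C$ be the category of boolean actions of $S$. (1) Suppose $S$ has a boolean action on $X$ and an ample action on $Y$, and let $\psi\colon X\to Y$ be a morphism of actions. Then $\psi$ is a topological embedding of $X$ as a closed subspace of $Y$. (2) Each homset of $\mathscr C$ contains at most one element. (3) The spectral action $\beta\colon S\to I_{\widehat{E(S)}}$ is the terminal object in $\mathscr C$.
   Context: An inverse semigroup is a semigroup $S$ such that each $s\in S$ has a unique $s^*$ with $ss^*s=s$, $s^*ss^*=s^*$; $E(S)$ is its commutative semigroup of idempotents. For a locally compact Hausdorff space $X$, $I_X$ is the inverse semigroup of homeomorphisms between open subsets of $X$. An action of $S$ on $X$ is a homomorphism $\varphi\colon S\to I_X$; write $sx=\varphi_s(x)$ for $x\in\mathrm{dom}(\varphi_s)$, and $X_e$ for the domain of $\varphi_e$, $e\in E(S)$. It is non-degenerate if $X=\bigcup_{e\in E(S)}X_e$. A morphism from an action on $X$ to an action on $Y$ is a continuous map $\alpha\colon X\to Y$ such that for all $s\in S$, $x\in X$, $sx$ is defined iff $s\alpha(x)$ is defined, in which case $\alpha(sx)=s\alpha(x)$. For a Hausdorff space $X$, $B(X)$ is the generalized boolean algebra of compact open subsets of $X$ (operations: finite unions, finite non-empty intersections, relative complements). A non-degenerate action on $X$ is ample if $X$ is Hausdorff with a basis of compact open sets and $X_e\in B(X)$ for all $e\in E(S)$. It is boolean if in addition $\{X_e\mid e\in E(S)\}$ generates $B(X)$ as a generalized boolean algebra. Boolean actions of $S$ form a category in which the morphisms from a boolean action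 on $X$ to a boolean action on $Y$ are the morphisms of actions, i.e. the continuous maps $\alpha\colon X\to Y$ such that for all $s\in S$, $x\in X$, $sx$ is defined iff $s\alpha(x)$ is defined, in which case $\alpha(sx)=s\alpha(x)$. $\widehat{E(S)}$ is the space of non-zero semilattice homomorphisms $\varphi\colon E(S)\to\{0,1\}$ with the subspace topology from $\{0,1\}^{E(S)}$; $D(e)=\{\varphi\mid\varphi(e)=1\}$. The spectral action $\beta$ sends $s\in S$ to $\beta_s\colon D(s^*s)\to D(ss^* )$, $\beta_s(\varphi)(e)=\varphi(s^*es)$; it is a boolean action. *)

theory Defs
  imports "HOL-Analysis.Analysis"
begin

class inverse_semigroup = semigroup_mult +
  assumes ex1_generalized_inverse: "\<exists>!t. s * t * s = s \<and> t * s * t = t"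

definition star :: "'s::inverse_semigroup \<Rightarrow> 's" where
  "star s = (THE t. s * t * s = s \<and> t * s * t = t)"

definition idems :: "'s::inverse_semigroup set" where
  "idems = {e. e * e = e}"

text \<open>Elements of \<open>I_X\<close> are partial maps of type \<open>'x \<rightharpoonup> 'x\<close>; their product is composition on the
  largest possible domain, which is the library's \<open>\<circ>\<^sub>m\<close>.  The empty map is allowed.\<close>

definition partial_homeos :: "'x topology \<Rightarrow> ('x \<rightharpoonup> 'x) set" where
  "partial_homeos X = {f. openin X (dom f) \<and> openin X (ran f) \<and>
     homeomorphic_map (subtopology X (dom f)) (subtopology X (ran f)) (the \<circ> f)}"

definition action :: "'x topology \<Rightarrow> ('s::inverse_semigroup \<Rightarrow> 'x \<rightharpoonup> 'x) \<Rightarrow> bool" where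
  "action X \<phi> \<longleftrightarrow> locally_compact_space X \<and> Hausdorff_space X \<and>
     (\<forall>s. \<phi> s \<in> partial_homeos X) \<and> (\<forall>s t. \<phi> (s * t) = \<phi> s \<circ>\<^sub>m \<phi> t)"

definition nondegenerate :: "'x topology \<Rightarrow> ('s::inverse_semigroup \<Rightarrow> 'x \<rightharpoonup> 'x) \<Rightarrow> bool" where
  "nondegenerate X \<phi> \<longleftrightarrow> topspace X = (\<Union>e\<in>idems. dom (\<phi> e))"

definition action_morphism ::
  "'x topology \<Rightarrow> ('s::inverse_semigroup \<Rightarrow> 'x \<rightharpoonup> 'x) \<Rightarrow>
   'y topology \<Rightarrow> ('s \<Rightarrow> 'y \<rightharpoonup> 'y) \<Rightarrow> ('x \<Rightarrow> 'y) \<Rightarrow> bool" where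
  "action_morphism X \<phi> Y \<theta> \<alpha> \<longleftrightarrow> continuous_map X Y \<alpha> \<and>
     (\<forall>s. \<forall>x\<in>topspace X. (x \<in> dom (\<phi> s) \<longleftrightarrow> \<alpha> x \<in> dom (\<theta> s)) \<and>
        (x \<in> dom (\<phi> s) \<longrightarrow> \<alpha> (the (\<phi> s x)) = the (\<theta> s (\<alpha> x))))"

definition compact_opens :: "'x topology \<Rightarrow> 'x set set" where
  "compact_opens X = {K. compactin X K \<and> openin X K}"

inductive_set generated_gba :: "'x set set \<Rightarrow> 'x set set" for G :: "'x set set" where
  generator: "A \<in> G \<Longrightarrow> A \<in> generated_gba G"
| empty: "{} \<in> generated_gba G"
| union: "A \<in> generated_gba G \<Longrightarrow> B \<in> generated_gba G \<Longrightarrow> A \<union> B \<in> generated_gba G"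
| inter: "A \<in> generated_gba G \<Longrightarrow> B \<in> generated_gba G \<Longrightarrow> A \<inter> B \<in> generated_gba G"
| diff: "A \<in> generated_gba G \<Longrightarrow> B \<in> generated_gba G \<Longrightarrow> A - B \<in> generated_gba G"

definition ample_action :: "'x topology \<Rightarrow> ('s::inverse_semigroup \<Rightarrow> 'x \<rightharpoonup> 'x) \<Rightarrow> bool" where
  "ample_action X \<phi> \<longleftrightarrow> action X \<phi> \<and> nondegenerate X \<phi> \<and> Hausdorff_space X \<and>
     openin X = arbitrary union_of (\<lambda>K. K \<in> compact_opens X) \<and>
     (\<forall>e\<in>idems. dom (\<phi> e) \<in> compact_opens X)"

definition boolean_action :: "'x topology \<Rightarrow> ('s::inverse_semigroup \<Rightarrow> 'x \<rightharpoonup> 'x) \<Rightarrow> bool" where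
  "boolean_action X \<phi> \<longleftrightarrow> ample_action X \<phi> \<and>
     generated_gba ((\<lambda>e. dom (\<phi> e)) ` idems) = compact_opens X"

text \<open>Morphisms are functions on the points of \<open>X\<close>, so their values outside \<open>topspace X\<close> are
  fixed by extensionality; otherwise equality of morphisms would be too fine.\<close>

definition boolean_hom ::
  "'x topology \<Rightarrow> ('s::inverse_semigroup \<Rightarrow> 'x \<rightharpoonup> 'x) \<Rightarrow>
   'y topology \<Rightarrow> ('s \<Rightarrow> 'y \<rightharpoonup> 'y) \<Rightarrow> ('x \<Rightarrow> 'y) set" where
  "boolean_hom X \<phi> Y \<theta> = {\<alpha> \<in> extensional (topspace X). action_morphism X \<phi> Y \<theta> \<alpha>}"

text \<open>The semilattice \<open>{0,1}\<close> is \<open>{0,1::nat}\<close> under multiplication.\<close>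

definition characters :: "('s::inverse_semigroup \<Rightarrow> nat) set" where
  "characters = {\<omega> \<in> idems \<rightarrow>\<^sub>E {0, 1}.
     (\<forall>e\<in>idems. \<forall>f\<in>idems. \<omega> (e * f) = \<omega> e * \<omega> f) \<and> (\<exists>e\<in>idems. \<omega> e \<noteq> 0)}"

definition spectral_space :: "('s::inverse_semigroup \<Rightarrow> nat) topology" where
  "spectral_space = subtopology (product_topology (\<lambda>_. discrete_topology {0, 1}) idems) characters"

definition spectral_domain :: "'s::inverse_semigroup \<Rightarrow> ('s \<Rightarrow> nat) set" where
  "spectral_domain e = {\<omega> \<in> characters. \<omega> e = 1}"

definition spectral_action :: "'s::inverse_semigroup \<Rightarrow> ('s \<Rightarrow> nat) \<rightharpoonup> ('s \<Rightarrow> nat)" where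
  "spectral_action s \<omega> = (if \<omega> \<in> spectral_domain (star s * s)
     then Some (\<lambda>e\<in>idems. \<omega> (star s * e * s)) else None)"

end

theory Submission
  imports Defs
begin

text \<open>
  The compact open sets of a boolean action are boolean combinations of the domains \<open>X\<^sub>e\<close>, and a
  morphism pulls \<open>Y\<^sub>e\<close> back to \<open>X\<^sub>e\<close>. Hence points of \<open>X\<close> are separated by their images (a
  morphism out of a boolean action is injective), and two morphisms into a boolean action cannot
  be told apart by compact open sets (they coincide). A morphism into an ample action is closed,
  since the image of a closed set meets each \<open>Y\<^sub>e\<close> in a compact set and the \<open>Y\<^sub>e\<close> are an open
  cover. The morphism to the spectral action sends \<open>x\<close> to the indicator of \<open>{e. x \<in> X\<^sub>e}\<close>.
\<close>

section \<open>Inverse semigroups\<close>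

lemma mult_star_mult: "s * star s * s = s"
  and star_mult_star: "star s * s * star s = star (s::'s::inverse_semigroup)"
  using theI'[OF ex1_generalized_inverse[of s]] unfolding star_def by auto

lemma star_unique:
  fixes s t :: "'s::inverse_semigroup"
  assumes "s * t * s = s" "t * s * t = t"
  shows "star s = t"
  using ex1_generalized_inverse[of s] assms mult_star_mult[of s] star_mult_star[of s] by blast

lemma star_star [simp]: "star (star s) = (s::'s::inverse_semigroup)"
  by (intro star_unique mult_star_mult star_mult_star)

text \<open>The defining identities in right-nested form, so that they still apply after rewriting
  with \<open>mult.assoc\<close>.\<close>

lemma mult_star_cancel [simp]:
  fixes s :: "'s::inverse_semigroup"
  shows "s * (star s * s) = s" "star s * (s * star s) = star s"
    "s * (star s * (s * t)) = s * t" "star s * (s * (star s * t)) = star s * t"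
  by (metis mult_star_mult star_mult_star mult.assoc)+

lemma idems_mult_self: "e \<in> idems \<Longrightarrow> e * e = e"
  by (simp add: idems_def)

lemma idems_mult_self_left: "e \<in> idems \<Longrightarrow> e * (e * t) = e * t"
  by (simp add: idems_def flip: mult.assoc)

lemma star_idem: "e \<in> idems \<Longrightarrow> star e = e"
  by (rule star_unique) (simp_all add: idems_def)

lemma star_mult_in_idems [simp]: "star s * s \<in> idems"
  and mult_star_in_idems [simp]: "s * star s \<in> idems"
  by (simp_all add: idems_def mult.assoc)

text \<open>With \<open>x = (ef)*\<close>, also \<open>fxe\<close> is an inverse of \<open>ef\<close>, so \<open>x = fxe\<close>; this is idempotent.\<close>

lemma idems_mult [simp]:
  fixes e f :: "'s::inverse_semigroup"
  assumes e: "e \<in> idems" and f: "f \<in> idems"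
  shows "e * f \<in> idems"
proof -
  define x where "x = star (e * f)"
  have x: "e * (f * (x * (e * f))) = e * f" "x * (e * (f * (x * t))) = x * t" for t
    using mult_star_mult[of "e * f"] mult_star_cancel(4)[of "e * f" t]
    by (simp_all only: x_def mult.assoc)
  have "star (e * f) = f * (x * e)"
    by (rule star_unique)
      (simp_all add: mult.assoc idems_mult_self_left[OF e] idems_mult_self_left[OF f] x)
  then have fxe: "x = f * (x * e)"
    by (simp add: x_def)
  have "x * x = f * (x * e) * (f * (x * e))"
    using fxe by simp
  also have "\<dots> = f * (x * e)"
    by (simp add: mult.assoc x)
  finally have "x \<in> idems"
    using fxe by (simp add: idems_def)
  \<comment> \<open>An idempotent is its own inverse, so \<open>e * f\<close> equals
    \<open>x\<close> itself.\<close>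
  moreover have "e * f = star x"
    by (simp add: x_def)
  ultimately show ?thesis
    by (simp add: star_idem)
qed

text \<open>Since \<open>e * f\<close> and \<open>f * e\<close> are both idempotent,
  \<open>f * e\<close> is an inverse of \<open>e * f\<close>; but \<open>e * f\<close> is also its
  own inverse, and inverses are unique.\<close>

lemma idems_commute:
  fixes e f :: "'s::inverse_semigroup"
  assumes e: "e \<in> idems" and f: "f \<in> idems"
  shows "e * f = f * e"
proof -
  note i = idems_mult_self[OF idems_mult[OF e f]] idems_mult_self[OF idems_mult[OF f e]]
  have "star (e * f) = f * e"
    by (rule star_unique)
      (use i in \<open>simp_all add: mult.assoc idems_mult_self_left[OF e] idems_mult_self_left[OF f]\<close>)
  then show ?thesis
    using star_idem[OF idems_mult[OF e f]] by simp
qed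

lemma idems_commute_left:
  fixes e f t :: "'s::inverse_semigroup"
  assumes "e \<in> idems" "f \<in> idems"
  shows "e * (f * t) = f * (e * t)"
  by (metis assms idems_commute mult.assoc)

text \<open>In both identities for the inverse, the idempotents \<open>star s * s\<close> and
  \<open>t * star t\<close> meet in the middle; after they are swapped, everything cancels.\<close>

lemma star_mult:
  fixes s t :: "'s::inverse_semigroup"
  shows "star (s * t) = star t * star s"
proof (rule star_unique)
  have c: "(star s * s) * (t * star t) = (t * star t) * (star s * s)" for s t :: 's
    by (simp add: idems_commute)
  have "s * t * (star t * star s) * (s * t) = s * ((t * star t) * (star s * s)) * t"
    by (simp add: mult.assoc)
  also have "\<dots> = s * ((star s * s) * (t * star t)) * t"
    by (simp only: c)
  also have "\<dots> = s * t"
    by (simp add: mult.assoc)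
  finally show "s * t * (star t * star s) * (s * t) = s * t" .
  have "star t * star s * (s * t) * (star t * star s)
      = star t * ((star s * s) * (t * star t)) * star s"
    by (simp add: mult.assoc)
  also have "\<dots> = star t * ((t * star t) * (star s * s)) * star s"
    by (simp only: c)
  also have "\<dots> = star t * star s"
    by (simp add: mult.assoc)
  finally show "star t * star s * (s * t) * (star t * star s) = star t * star s" .
qed

text \<open>Commutation of \<open>e\<close> with the idempotent \<open>s * star s\<close>, in
  right-nested form. This makes conjugation by \<open>s\<close> an endomorphism of the semilattice
  of idempotents.\<close>

lemma mult_star_idem_swap:
  fixes s t :: "'s::inverse_semigroup"
  assumes "e \<in> idems"
  shows "s * (star s * (e * t)) = e * (s * (star s * t))"
  using idems_commute_left[OF mult_star_in_idems assms, of s t] by (simp add: mult.assoc)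

lemma conj_in_idems [simp]:
  fixes s :: "'s::inverse_semigroup"
  assumes "e \<in> idems"
  shows "star s * e * s \<in> idems"
  by (simp add: idems_def mult.assoc mult_star_idem_swap[OF assms]
      idems_mult_self_left[OF assms])

text \<open>The inner \<open>s * star s\<close> on the right moves past \<open>f\<close> and is
  absorbed by the final \<open>s\<close>.\<close>

lemma conj_mult:
  fixes s :: "'s::inverse_semigroup"
  assumes "e \<in> idems" "f \<in> idems"
  shows "star s * (e * f) * s = (star s * e * s) * (star s * f * s)"
  by (simp add: mult.assoc mult_star_idem_swap[OF assms(2)])

section \<open>Actions\<close>

lemma action_mult: "action X \<phi> \<Longrightarrow> \<phi> (s * t) x = (\<phi> s \<circ>\<^sub>m \<phi> t) x"
  by (simp add: action_def)

text \<open>If \<open>e\<close> sends \<open>x\<close> to \<open>y\<close>, then idempotence makes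
  it fix \<open>y\<close>, and injectivity of the partial homeomorphism forces
  \<open>x = y\<close>.\<close>

lemma action_idem:
  assumes act: "action X \<phi>" and e: "e \<in> idems" and x: "x \<in> dom (\<phi> e)"
  shows "\<phi> e x = Some x"
proof -
  obtain y where y: "\<phi> e x = Some y"
    using x by auto
  have y': "\<phi> e y = Some y"
    using action_mult[OF act, of e e x] y e by (simp add: idems_def)
  have "\<phi> e \<in> partial_homeos X"
    using act by (simp add: action_def)
  then have "inj_on (the \<circ> \<phi> e) (dom (\<phi> e))"
    by (auto simp: partial_homeos_def homeomorphic_eq_everything_map dest: openin_subset
        simp: Int_absorb1)
  then have "x = y"
    using y y' by (auto dest!: inj_onD[of _ _ x y])
  then show ?thesis
    using y by simp
qed

lemma action_dom_mult_idems:
  assumes act: "action X \<phi>" and "e \<in> idems" "f \<in> idems"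
  shows "dom (\<phi> (e * f)) = dom (\<phi> e) \<inter> dom (\<phi> f)"
  using action_idem[OF act assms(3)]
  by (fastforce simp: dom_def action_mult[OF act] map_comp_def split: option.splits)

lemma action_dom_mult_subset:
  assumes "action X \<phi>"
  shows "dom (\<phi> (s * t)) \<subseteq> dom (\<phi> t)"
  by (auto simp: action_mult[OF assms] map_comp_def split: option.splits)

text \<open>Each of \<open>s\<close> and \<open>star s * s\<close> is a left multiple of the other,
  and a left multiple has the smaller domain.\<close>

lemma action_dom_star_mult:
  assumes "action X \<phi>"
  shows "dom (\<phi> (star s * s)) = dom (\<phi> s)"
  using action_dom_mult_subset[OF assms, of "star s" s]
    action_dom_mult_subset[OF assms, of s "star s * s"] by auto

text \<open>The elements \<open>star s * e * s\<close> and \<open>e * s\<close> are left multiples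
  of each other, so they have the same domain. This later gives equivariance of the canonical
  map.\<close>

lemma action_dom_conj:
  fixes s :: "'s::inverse_semigroup"
  assumes act: "action X \<phi>" and e: "e \<in> idems" and x: "\<phi> s x = Some y"
  shows "x \<in> dom (\<phi> (star s * e * s)) \<longleftrightarrow> y \<in> dom (\<phi> e)"
proof -
  have "s * (star s * e * s) = e * s"
    by (simp add: mult.assoc mult_star_idem_swap[OF e])
  then have "dom (\<phi> (star s * e * s)) = dom (\<phi> (e * s))"
    using action_dom_mult_subset[OF act, of "star s" "e * s"]
      action_dom_mult_subset[OF act, of s "star s * e * s"] by (auto simp: mult.assoc)
  then show ?thesis
    using x by (auto simp: action_mult[OF act] dom_def)
qed

lemma action_morphism_dom_iff:
  "action_morphism X \<phi> Y \<theta> \<alpha> \<Longrightarrow> x \<in> topspace X \<Longrightarrow> \<alpha> x \<in> dom (\<theta> s) \<longleftrightarrow> x \<in> dom (\<phi> s)"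
  unfolding action_morphism_def by blast

lemma action_morphism_image:
  "action_morphism X \<phi> Y \<theta> \<alpha> \<Longrightarrow> x \<in> topspace X \<Longrightarrow> \<alpha> x \<in> topspace Y"
  unfolding action_morphism_def continuous_map_def by blast

section \<open>Compact open sets and morphisms\<close>

text \<open>In a Hausdorff space compact sets are closed, so intersections and differences of
  compact open sets are again compact and open.\<close>

lemma generated_gba_subset_compact_opens:
  assumes H: "Hausdorff_space X" and G: "G \<subseteq> compact_opens X"
  shows "generated_gba G \<subseteq> compact_opens X"
proof
  fix A assume "A \<in> generated_gba G"
  then show "A \<in> compact_opens X"
  proof induction
    case (inter A B)
    then show ?case
      using compact_Int_closedin[of X A B] compactin_imp_closedin[OF H, of B]
      by (auto simp: compact_opens_def)
  next
    case (diff A B)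
    then have "A - B = A \<inter> (topspace X - B)" "closedin X B"
      using compactin_imp_closedin[OF H] by (auto simp: compact_opens_def dest: openin_subset)
    then show ?case
      using diff compact_Int_closedin[of X A "topspace X - B"]
      by (auto simp: compact_opens_def)
  qed (use G in \<open>auto simp: compact_opens_def intro: compactin_Un\<close>)
qed

lemma generated_gba_Union:
  "finite F \<Longrightarrow> F \<subseteq> generated_gba G \<Longrightarrow> \<Union>F \<in> generated_gba G"
  by (induction F rule: finite_induct)
    (auto intro: generated_gba.empty generated_gba.union)

text \<open>A compact open set is covered by the generated open sets inside it, hence is a finite
  union of them.\<close>

lemma compact_opens_subset_generated_gba:
  assumes base: "\<And>U x. openin X U \<Longrightarrow> x \<in> U \<Longrightarrow>
      \<exists>K\<in>generated_gba G. openin X K \<and> x \<in> K \<and> K \<subseteq> U"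
  shows "compact_opens X \<subseteq> generated_gba G"
proof
  fix K assume K: "K \<in> compact_opens X"
  define \<U> where "\<U> = {A \<in> generated_gba G. openin X A \<and> A \<subseteq> K}"
  have "K \<subseteq> \<Union>\<U>"
    using base K by (fastforce simp: \<U>_def compact_opens_def)
  then obtain \<F> where \<F>: "finite \<F>" "\<F> \<subseteq> \<U>" "K \<subseteq> \<Union>\<F>"
    using compactinD[of X K \<U>] K by (auto simp: \<U>_def compact_opens_def)
  then have "K = \<Union>\<F>"
    by (auto simp: \<U>_def)
  then show "K \<in> generated_gba G"
    using generated_gba_Union[of \<F> G] \<F> by (auto simp: \<U>_def)
qed

lemma generated_gba_mem_cong:
  assumes "\<And>A. A \<in> G \<Longrightarrow> x \<in> A \<longleftrightarrow> y \<in> A" "B \<in> generated_gba G"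
  shows "x \<in> B \<longleftrightarrow> y \<in> B"
  using assms(2) by induction (use assms(1) in auto)

lemma ample_action_separates:
  assumes Y: "ample_action Y \<theta>" and x: "x \<in> topspace Y" and y: "y \<in> topspace Y"
    and K: "\<And>K. K \<in> compact_opens Y \<Longrightarrow> x \<in> K \<longleftrightarrow> y \<in> K"
  shows "x = y"
proof (rule ccontr)
  assume "x \<noteq> y"
  with Y x y obtain U where U: "openin Y U" "x \<in> U" "y \<notin> U"
    by (auto simp: ample_action_def Hausdorff_space_def disjnt_iff) metis
  then have "(arbitrary union_of (\<lambda>K. K \<in> compact_opens Y)) U"
    using Y by (simp add: ample_action_def)
  then obtain K where "K \<in> compact_opens Y" "x \<in> K" "K \<subseteq> U"
    using U(2) by (auto simp: union_of_def arbitrary_def)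
  with U K show False
    by blast
qed

text \<open>Compact open sets separate points, and membership in them is decided by membership in
  the generating domains. Injectivity of morphisms from, and uniqueness of morphisms into, a boolean
  action both rest on this.\<close>

lemma boolean_action_separates:
  assumes Y: "boolean_action Y \<theta>" and "x \<in> topspace Y" "y \<in> topspace Y"
    and dom: "\<And>e. e \<in> idems \<Longrightarrow> x \<in> dom (\<theta> e) \<longleftrightarrow> y \<in> dom (\<theta> e)"
  shows "x = y"
proof (rule ample_action_separates[OF _ assms(2,3)])
  show "ample_action Y \<theta>"
    using Y by (simp add: boolean_action_def)
  fix K assume "K \<in> compact_opens Y"
  then have "K \<in> generated_gba ((\<lambda>e. dom (\<theta> e)) ` idems)"
    using Y by (simp add: boolean_action_def)
  then show "x \<in> K \<longleftrightarrow> y \<in> K"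
    by (rule generated_gba_mem_cong[rotated]) (use dom in blast)
qed

section \<open>Closed embeddings and uniqueness of morphisms\<close>

lemma action_morphism_inj_on:
  assumes "boolean_action X \<phi>" "action_morphism X \<phi> Y \<theta> \<psi>"
  shows "inj_on \<psi> (topspace X)"
  by (rule inj_onI, rule boolean_action_separates[OF assms(1)])
    (use action_morphism_dom_iff[OF assms(2)] in metis)+

lemma action_morphism_closed_map:
  assumes X: "ample_action X \<phi>" and Y: "ample_action Y \<theta>"
    and \<psi>: "action_morphism X \<phi> Y \<theta> \<psi>"
  shows "closed_map X Y \<psi>"
  unfolding closed_map_def
proof (intro allI impI)
  fix C assume C: "closedin X C"
  then have CX: "C \<subseteq> topspace X"
    by (rule closedin_subset)
  have nbhd: "\<exists>T. openin Y T \<and> y \<in> T \<and> T \<subseteq> topspace Y - \<psi> ` C"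
    if y: "y \<in> topspace Y - \<psi> ` C" for y
  proof -
    \<comment> \<open>Non-degeneracy puts \<open>y\<close> in some open Y_e; only the part of
      \<open>C\<close> in the compact set X_e can map into it.\<close>
    obtain e where e: "e \<in> idems" "y \<in> dom (\<theta> e)"
      using Y y by (auto simp: ample_action_def nondegenerate_def)
    have "dom (\<phi> e) \<in> compact_opens X"
      using X e by (simp add: ample_action_def)
    then have "compactin X (dom (\<phi> e) \<inter> C)"
      using compact_Int_closedin C by (auto simp: compact_opens_def)
    then have "compactin Y (\<psi> ` (dom (\<phi> e) \<inter> C))"
      using \<psi> by (intro image_compactin) (auto simp: action_morphism_def)
    then have cl: "closedin Y (\<psi> ` (dom (\<phi> e) \<inter> C))"
      using Y by (intro compactin_imp_closedin) (auto simp: ample_action_def)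
    have op: "openin Y (dom (\<theta> e))"
      using Y e by (simp add: ample_action_def compact_opens_def)
    have "openin Y (dom (\<theta> e) - \<psi> ` (dom (\<phi> e) \<inter> C))"
      by (rule openin_diff[OF op cl])
    moreover have "dom (\<theta> e) - \<psi> ` (dom (\<phi> e) \<inter> C) \<subseteq> topspace Y - \<psi> ` C"
    proof -
      \<comment> \<open>A morphism reflects domains, so removing the image of X_e \<inter> C from
        Y_e already removes all of the image of \<open>C\<close>.\<close>
      have "x \<in> dom (\<phi> e)" if "x \<in> C" "\<psi> x \<in> dom (\<theta> e)" for x
        using that action_morphism_dom_iff[OF \<psi>] CX by blast
      then show ?thesis
        using openin_subset[OF op] by blast
    qed
    ultimately show ?thesis
      using e y by blast
  qed
  have "openin Y (topspace Y - \<psi> ` C)"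
    by (subst openin_subopen) (use nbhd in blast)
  moreover have "\<psi> ` C \<subseteq> topspace Y"
    using action_morphism_image[OF \<psi>] CX by auto
  ultimately show "closedin Y (\<psi> ` C)"
    by (simp add: closedin_def)
qed

text \<open>A continuous closed injection is an embedding, and its range is the image of the closed
  set \<open>topspace X\<close>.\<close>

lemma action_morphism_closed_embedding:
  assumes X: "boolean_action X \<phi>" and Y: "ample_action Y \<theta>"
    and \<psi>: "action_morphism X \<phi> Y \<theta> \<psi>"
  shows "embedding_map X Y \<psi>" "closedin Y (\<psi> ` topspace X)"
proof -
  have "closed_map X Y \<psi>"
    using action_morphism_closed_map[OF _ Y \<psi>] X by (simp add: boolean_action_def)
  then show "embedding_map X Y \<psi>" "closedin Y (\<psi> ` topspace X)"
    using \<psi> action_morphism_inj_on[OF X \<psi>]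
    by (auto simp: closed_map_def action_morphism_def intro!: injective_closed_imp_embedding_map)
qed

text \<open>Both \<alpha>(x) and \<beta>(x) lie in exactly those Y_e for which x lies in X_e, so
  they cannot be separated.\<close>

lemma boolean_hom_unique:
  assumes Y: "boolean_action Y \<theta>"
    and \<alpha>: "\<alpha> \<in> boolean_hom X \<phi> Y \<theta>" and \<beta>: "\<beta> \<in> boolean_hom X \<phi> Y \<theta>"
  shows "\<alpha> = \<beta>"
proof (rule extensionalityI[of _ "topspace X"])
  fix x assume x: "x \<in> topspace X"
  have m: "action_morphism X \<phi> Y \<theta> \<alpha>" "action_morphism X \<phi> Y \<theta> \<beta>"
    using \<alpha> \<beta> by (auto simp: boolean_hom_def)
  show "\<alpha> x = \<beta> x"
    by (rule boolean_action_separates[OF Y])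
      (use m x in \<open>simp_all add: action_morphism_image[of X] action_morphism_dom_iff[of X]\<close>)
qed (use \<alpha> \<beta> in \<open>auto simp: boolean_hom_def\<close>)

section \<open>The spectral action\<close>

abbreviation idem_cube :: "('s::inverse_semigroup \<Rightarrow> nat) topology" where
  "idem_cube \<equiv> product_topology (\<lambda>_. discrete_topology {0, 1}) idems"

lemma characters_mult:
  "\<omega> \<in> characters \<Longrightarrow> e \<in> idems \<Longrightarrow> f \<in> idems \<Longrightarrow> \<omega> (e * f) = \<omega> e * \<omega> f"
  by (simp add: characters_def)

lemma characters_cases: "\<omega> \<in> characters \<Longrightarrow> e \<in> idems \<Longrightarrow> \<omega> e = 0 \<or> \<omega> e = 1"
  by (auto simp: characters_def PiE_iff)

lemma characters_subset: "characters \<subseteq> topspace idem_cube"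
  unfolding characters_def topspace_product_topology topspace_discrete_topology by blast

lemma topspace_spectral_space: "topspace spectral_space = characters"
  unfolding spectral_space_def topspace_subtopology using characters_subset by blast

lemma spectral_domain_subset: "spectral_domain e \<subseteq> characters"
  by (auto simp: spectral_domain_def)

lemma continuous_map_idem_cube_eval:
  "e \<in> idems \<Longrightarrow> continuous_map idem_cube (discrete_topology {0, 1}) (\<lambda>\<omega>. \<omega> e)"
  by (rule continuous_map_product_projection[where X = "\<lambda>_. discrete_topology {0, 1}"])

lemma clopen_idem_cube_eval:
  assumes "e \<in> idems"
  shows "openin idem_cube {\<omega> \<in> topspace idem_cube. \<omega> e \<in> U}"
    "closedin idem_cube {\<omega> \<in> topspace idem_cube. \<omega> e \<in> U}"
proof -
  \<comment> \<open>\<open>U\<close> is any set of naturals, but the open and closed sets of the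
    discrete factor are subsets of {0, 1}.\<close>
  have *: "{\<omega> \<in> topspace idem_cube. \<omega> e \<in> U} = {\<omega> \<in> topspace idem_cube. \<omega> e \<in> U \<inter> {0, 1}}"
    using assms by auto
  show "openin idem_cube {\<omega> \<in> topspace idem_cube. \<omega> e \<in> U}"
    unfolding * by (rule openin_continuous_map_preimage[OF continuous_map_idem_cube_eval[OF assms]])
      simp
  show "closedin idem_cube {\<omega> \<in> topspace idem_cube. \<omega> e \<in> U}"
    unfolding * by (rule closedin_continuous_map_preimage[OF continuous_map_idem_cube_eval[OF assms]])
      simp
qed

text \<open>For values in {0, 1} the equation amounts to three combinations of values at
  \<open>e\<close>, \<open>f\<close> and \<open>e * f\<close>, each a clopen condition.\<close>

lemma closedin_mult_condition:
  fixes e f :: "'s::inverse_semigroup"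
  assumes "e \<in> idems" "f \<in> idems"
  shows "closedin idem_cube {\<omega> \<in> topspace idem_cube. \<omega> (e * f) = \<omega> e * \<omega> f}"
proof -
  let ?A = "\<lambda>e a. {\<omega> \<in> topspace idem_cube. \<omega> e \<in> {a}}"
  have "\<omega> (e * f) = \<omega> e * \<omega> f \<longleftrightarrow> \<omega> (e * f) = 1 \<and> \<omega> e = 1 \<and> \<omega> f = 1 \<or>
      \<omega> (e * f) = 0 \<and> \<omega> e = 0 \<or> \<omega> (e * f) = 0 \<and> \<omega> f = 0"
    if "\<omega> \<in> topspace idem_cube" for \<omega> :: "'s \<Rightarrow> nat"
  proof -
    have "\<omega> e = 0 \<or> \<omega> e = 1" "\<omega> f = 0 \<or> \<omega> f = 1" "\<omega> (e * f) = 0 \<or> \<omega> (e * f) = 1"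
      using that assms idems_mult[OF assms] by (auto simp: PiE_iff)
    then show ?thesis
      by auto
  qed
  then have "{\<omega> \<in> topspace idem_cube. \<omega> (e * f) = \<omega> e * \<omega> f}
      = (?A (e * f) 1 \<inter> ?A e 1 \<inter> ?A f 1) \<union> (?A (e * f) 0 \<inter> ?A e 0) \<union> (?A (e * f) 0 \<inter> ?A f 0)"
    by blast
  then show ?thesis
    by (simp only:) (intro closedin_Un closedin_Int clopen_idem_cube_eval(2) idems_mult assms)
qed

lemma openin_spectral_domain:
  assumes "e \<in> idems"
  shows "openin spectral_space (spectral_domain e)"
proof -
  have "spectral_domain e = {\<omega> \<in> topspace idem_cube. \<omega> e \<in> {1}} \<inter> characters"
    unfolding spectral_domain_def using characters_subset by blast
  then show ?thesis
    using clopen_idem_cube_eval(1)[OF assms] unfolding spectral_space_def openin_subtopology by blast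
qed

text \<open>The condition \<open>\<omega> \<noteq> 0\<close> is not closed, but it is implied by \<open>\<omega> e = 1\<close>.\<close>

lemma compactin_spectral_domain:
  fixes e :: "'s::inverse_semigroup"
  assumes "e \<in> idems"
  shows "compactin spectral_space (spectral_domain e)"
proof -
  have eq: "spectral_domain e = {\<omega> \<in> topspace idem_cube. \<omega> e \<in> {1}}
      \<inter> (\<Inter>(f, g)\<in>idems \<times> idems. {\<omega> \<in> topspace idem_cube. \<omega> (f * g) = \<omega> f * \<omega> g})"
    using assms by (auto simp: spectral_domain_def characters_def intro!: bexI[of _ e])
  have "closedin idem_cube (spectral_domain e)"
    unfolding eq using assms
    by (intro closedin_Int clopen_idem_cube_eval closedin_INT)
      (auto simp del: topspace_product_topology One_nat_def intro: closedin_mult_condition)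
  moreover have "compact_space (idem_cube :: ('s \<Rightarrow> nat) topology)"
    by (simp add: compact_space_product_topology compact_space_discrete_topology)
  ultimately have "compactin idem_cube (spectral_domain e)"
    by (rule closedin_compact_space[rotated])
  then show ?thesis
    by (auto simp: spectral_space_def compactin_subtopology spectral_domain_def)
qed

lemma spectral_domain_compact_opens:
  "e \<in> idems \<Longrightarrow> spectral_domain e \<in> compact_opens spectral_space"
  by (simp add: compact_opens_def openin_spectral_domain compactin_spectral_domain)

lemma Hausdorff_spectral_space: "Hausdorff_space spectral_space"
  by (simp add: spectral_space_def Hausdorff_space_subtopology Hausdorff_space_product_topology
      Hausdorff_space_discrete_topology)

lemma characters_nonzero: "\<omega> \<in> characters \<Longrightarrow> \<exists>e\<in>idems. \<omega> \<in> spectral_domain e"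
  using characters_cases[of \<omega>] by (fastforce simp: characters_def spectral_domain_def)

text \<open>A basic open set of the product constrains finitely many coordinates. Among characters,
  fixing the coordinate \<open>f\<close> to 1 or 0 means intersecting with D(f) or removing
  it.\<close>

lemma spectral_base:
  assumes U: "openin spectral_space U" and \<omega>: "\<omega> \<in> U"
  shows "\<exists>K\<in>generated_gba (spectral_domain ` idems). \<omega> \<in> K \<and> K \<subseteq> U"
proof -
  let ?B = "generated_gba (spectral_domain ` idems)"
  obtain T where T: "openin idem_cube T" "U = T \<inter> characters"
    using U unfolding spectral_space_def openin_subtopology by blast
  have \<omega>c: "\<omega> \<in> characters"
    using T \<omega> by blast
  have "\<omega> \<in> T"
    using T(2) \<omega> by blast
  from bspec[OF T(1)[unfolded openin_product_topology_alt topspace_discrete_topology] this]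
  obtain V where V: "finite {i \<in> idems. V i \<noteq> {0, 1}}" "\<omega> \<in> Pi\<^sub>E idems V" "Pi\<^sub>E idems V \<subseteq> T"
    by (elim exE conjE)
  \<comment> \<open>A generalized boolean algebra need not have a top element, so D(e) serves as the
    set to start from.\<close>
  obtain e where e: "e \<in> idems" "\<omega> \<in> spectral_domain e"
    using characters_nonzero[OF \<omega>c] by blast
  have sep: "\<exists>K\<in>?B. \<omega> \<in> K \<and> K \<subseteq> characters \<and> (\<forall>\<omega>'\<in>K. \<forall>f\<in>F. \<omega>' f = \<omega> f)"
    if "finite F" "F \<subseteq> idems" for F
    using that
  proof (induction F rule: finite_induct)
    case empty
    show ?case
      using e(2) spectral_domain_subset[of e]
      by (intro bexI[OF _ generated_gba.generator[OF imageI[OF e(1)]]]) blast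
  next
    case (insert f F)
    then obtain K where K: "K \<in> ?B" "\<omega> \<in> K" "K \<subseteq> characters" "\<forall>\<omega>'\<in>K. \<forall>f\<in>F. \<omega>' f = \<omega> f"
      by auto
    have f: "f \<in> idems" and fB: "spectral_domain f \<in> ?B"
      using insert.prems by (auto intro: generated_gba.generator)
    show ?case
    proof (cases "\<omega> f = 1")
      case True
      then have "\<omega> \<in> K \<inter> spectral_domain f"
        using K(2) \<omega>c by (simp add: spectral_domain_def)
      moreover have "\<omega>' f = \<omega> f" if "\<omega>' \<in> spectral_domain f" for \<omega>'
        using that True by (simp add: spectral_domain_def)
      ultimately show ?thesis
        using K(3,4) by (intro bexI[OF _ generated_gba.inter[OF K(1) fB]]) blast
    next
      case False
      then have "\<omega> f = 0"
        using characters_cases[OF \<omega>c f] by simp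
      then have "\<omega>' f = \<omega> f" if "\<omega>' \<in> K - spectral_domain f" for \<omega>'
        using that characters_cases[of \<omega>' f] f K(3) by (auto simp: spectral_domain_def)
      moreover have "\<omega> \<in> K - spectral_domain f"
        using K(2) False by (simp add: spectral_domain_def)
      ultimately show ?thesis
        using K(3,4) by (intro bexI[OF _ generated_gba.diff[OF K(1) fB]]) blast
    qed
  qed
  \<comment> \<open>Agreement with \<omega> is imposed at exactly the finitely many constrained
    coordinates; elsewhere a character takes values in {0, 1} anyway.\<close>
  from sep[OF V(1) Collect_restrict]
  obtain K where K: "K \<in> ?B" "\<omega> \<in> K" "K \<subseteq> characters"
    "\<forall>\<omega>'\<in>K. \<forall>f\<in>{i \<in> idems. V i \<noteq> {0, 1}}. \<omega>' f = \<omega> f"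
    by (elim bexE conjE)
  have "K \<subseteq> Pi\<^sub>E idems V"
  proof
    fix \<omega>' assume \<omega>': "\<omega>' \<in> K"
    have "\<omega>' f \<in> V f" if "f \<in> idems" for f
    proof (cases "V f = {0, 1}")
      case True
      then show ?thesis
        using characters_cases[of \<omega>' f] that K(3) \<omega>' by auto
    next
      case False
      then have "\<omega>' f = \<omega> f"
        using K(4) \<omega>' that by blast
      then show ?thesis
        using PiE_mem[OF V(2) that] by simp
    qed
    then show "\<omega>' \<in> Pi\<^sub>E idems V"
      using K(3) \<omega>' by (auto simp: characters_def PiE_iff)
  qed
  then have "K \<subseteq> U"
    using K(3) V(3) unfolding T(2) by (metis Int_subset_iff order_trans)
  with K(1,2) show ?thesis
    by (metis bexI)
qed

lemma generated_gba_spectral_domain: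
  "generated_gba (spectral_domain ` idems) = compact_opens spectral_space"
proof
  show sub: "generated_gba (spectral_domain ` idems) \<subseteq> compact_opens spectral_space"
    using Hausdorff_spectral_space
    by (rule generated_gba_subset_compact_opens) (auto intro: spectral_domain_compact_opens)
  show "compact_opens spectral_space \<subseteq> generated_gba (spectral_domain ` idems)"
    by (rule compact_opens_subset_generated_gba)
      (use spectral_base sub in \<open>fastforce simp: compact_opens_def\<close>)
qed

section \<open>The spectral action by partial homeomorphisms\<close>

lemma dom_spectral_action: "dom (spectral_action s) = spectral_domain (star s * s)"
  by (auto simp: spectral_action_def dom_def)

lemma dom_spectral_action_idem: "e \<in> idems \<Longrightarrow> dom (spectral_action e) = spectral_domain e"
  by (simp add: dom_spectral_action star_idem idems_mult_self)

text \<open>Multiplicativity is \<open>conj_mult\<close>. The new character is non-zero at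
  \<open>s * star s\<close>, whose conjugate is \<open>star s * s\<close>.\<close>

lemma conj_character:
  assumes \<omega>: "\<omega> \<in> spectral_domain (star s * s)"
  shows "(\<lambda>e\<in>idems. \<omega> (star s * e * s)) \<in> spectral_domain (s * star s)"
proof -
  have \<omega>c: "\<omega> \<in> characters" and \<omega>1: "\<omega> (star s * s) = 1"
    using \<omega> by (auto simp: spectral_domain_def)
  have 1: "\<omega> (star s * (s * star s) * s) = 1"
    using \<omega>1 by (simp add: mult.assoc)
  have 2: "\<omega> (star s * e * s) \<in> {0, 1}" if "e \<in> idems" for e
    using characters_cases[OF \<omega>c] that by auto
  have 3: "\<omega> (star s * (e * f) * s) = \<omega> (star s * e * s) * \<omega> (star s * f * s)"
    if "e \<in> idems" "f \<in> idems" for e f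
    using characters_mult[OF \<omega>c] that by (simp add: conj_mult)
  show ?thesis
    using 1 2 3 mult_star_in_idems[of s]
    by (auto simp: spectral_domain_def characters_def intro!: bexI[of _ "s * star s"])
qed

text \<open>Conjugating twice multiplies \<open>e\<close> on both sides by
  \<open>star s * s\<close>, where \<omega> is 1. Hence conjugation by \<open>star s\<close> undoes
  conjugation by \<open>s\<close>.\<close>

lemma conj_conj_character:
  assumes \<omega>: "\<omega> \<in> spectral_domain (star s * s)" and e: "e \<in> idems"
  shows "\<omega> (star s * (s * e * star s) * s) = \<omega> e"
proof -
  have \<omega>c: "\<omega> \<in> characters" and \<omega>1: "\<omega> (star s * s) = 1"
    using \<omega> by (auto simp: spectral_domain_def)
  have "star s * (s * e * star s) * s = (star s * s) * (e * (star s * s))"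
    by (simp add: mult.assoc)
  then show ?thesis
    using \<omega>1 e by (simp add: characters_mult[OF \<omega>c])
qed

text \<open>Each coordinate of the image is a coordinate of \<omega>, the one at
  \<open>star s * e * s\<close>, so continuity can be checked componentwise.\<close>

lemma continuous_map_conj:
  "continuous_map (subtopology spectral_space (spectral_domain (star s * s)))
     (subtopology spectral_space (spectral_domain (s * star s)))
     (\<lambda>\<omega>. \<lambda>e\<in>idems. \<omega> (star s * e * s))"
proof -
  have "continuous_map spectral_space idem_cube (\<lambda>\<omega>. \<lambda>e\<in>idems. \<omega> (star s * e * s))"
    unfolding continuous_map_componentwise spectral_space_def
    by (auto intro!: continuous_map_from_subtopology
        continuous_map_idem_cube_eval[unfolded One_nat_def])
  then have "continuous_map (subtopology spectral_space (spectral_domain (star s * s))) idem_cube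
      (\<lambda>\<omega>. \<lambda>e\<in>idems. \<omega> (star s * e * s))"
    by (rule continuous_map_from_subtopology)
  moreover have "(\<lambda>e\<in>idems. \<omega> (star s * e * s)) \<in> characters \<inter> spectral_domain (s * star s)"
    if "\<omega> \<in> topspace (subtopology spectral_space (spectral_domain (star s * s)))" for \<omega>
    using that conj_character[of \<omega> s] spectral_domain_subset by auto
  ultimately have "continuous_map (subtopology spectral_space (spectral_domain (star s * s)))
      (subtopology (subtopology idem_cube characters) (spectral_domain (s * star s)))
      (\<lambda>\<omega>. \<lambda>e\<in>idems. \<omega> (star s * e * s))"
    unfolding continuous_map_in_subtopology by blast
  then show ?thesis
    by (simp only: spectral_space_def)
qed

lemma homeomorphic_maps_conj:
  fixes s :: "'s::inverse_semigroup"
  shows "homeomorphic_maps (subtopology spectral_space (spectral_domain (star s * s)))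
     (subtopology spectral_space (spectral_domain (s * star s)))
     (\<lambda>\<omega>. \<lambda>e\<in>idems. \<omega> (star s * e * s)) (\<lambda>\<omega>. \<lambda>e\<in>idems. \<omega> (s * e * star s))"
proof -
  have inverse: "(\<lambda>e\<in>idems. (\<lambda>e\<in>idems. \<omega> (star s * e * s)) (s * e * star s)) = \<omega>"
    if \<omega>: "\<omega> \<in> spectral_domain (star s * s)" for \<omega> and s :: 's
  proof
    fix e
    \<comment> \<open>Characters are extensional, so both sides also agree off the
      idempotents.\<close>
    have "\<omega> e = undefined" if "e \<notin> idems"
      using \<omega> that by (auto simp: spectral_domain_def characters_def)
    then show "(\<lambda>e\<in>idems. (\<lambda>e\<in>idems. \<omega> (star s * e * s)) (s * e * star s)) e = \<omega> e"
      using conj_conj_character[OF \<omega>] conj_in_idems[of e "star s"] by auto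
  qed
  show ?thesis
    using continuous_map_conj[of s] continuous_map_conj[of "star s"] inverse[of _ s]
      inverse[of _ "star s"]
    by (auto simp: homeomorphic_maps_def)
qed

lemma ran_spectral_action: "ran (spectral_action s) = spectral_domain (s * star s)"
proof -
  have "homeomorphic_map (subtopology spectral_space (spectral_domain (star s * s)))
     (subtopology spectral_space (spectral_domain (s * star s)))
     (\<lambda>\<omega>. \<lambda>e\<in>idems. \<omega> (star s * e * s))"
    using homeomorphic_maps_conj homeomorphic_map_maps by blast
  then have "(\<lambda>\<omega>. \<lambda>e\<in>idems. \<omega> (star s * e * s)) ` spectral_domain (star s * s)
      = spectral_domain (s * star s)"
    using spectral_domain_subset[of "star s * s"] spectral_domain_subset[of "s * star s"]
    by (auto dest!: homeomorphic_imp_surjective_map simp: topspace_spectral_space Int_absorb1)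
  moreover have "spectral_action s \<omega> = Some \<rho> \<longleftrightarrow>
      \<omega> \<in> spectral_domain (star s * s) \<and> \<rho> = (\<lambda>e\<in>idems. \<omega> (star s * e * s))" for \<omega> \<rho>
    by (auto simp: spectral_action_def)
  ultimately show ?thesis
    by (auto simp: ran_def)
qed

lemma spectral_action_partial_homeo: "spectral_action s \<in> partial_homeos spectral_space"
proof -
  have "homeomorphic_map (subtopology spectral_space (spectral_domain (star s * s)))
     (subtopology spectral_space (spectral_domain (s * star s)))
     (\<lambda>\<omega>. \<lambda>e\<in>idems. \<omega> (star s * e * s))"
    using homeomorphic_maps_conj homeomorphic_map_maps by blast
  then have "homeomorphic_map (subtopology spectral_space (spectral_domain (star s * s)))
     (subtopology spectral_space (spectral_domain (s * star s))) (the \<circ> spectral_action s)"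
    by (rule homeomorphic_map_eq) (auto simp: spectral_action_def)
  then show ?thesis
    by (simp add: partial_homeos_def dom_spectral_action ran_spectral_action openin_spectral_domain)
qed

text \<open>Conjugating an idempotent by \<open>s * t\<close> is conjugating it by \<open>s\<close>
  and then by \<open>t\<close>; evaluation at \<omega> reverses this order.\<close>

lemma spectral_action_mult:
  fixes s t :: "'s::inverse_semigroup"
  shows "spectral_action (s * t) = spectral_action s \<circ>\<^sub>m spectral_action t"
proof
  fix \<omega> :: "'s \<Rightarrow> nat"
  show "spectral_action (s * t) \<omega> = (spectral_action s \<circ>\<^sub>m spectral_action t) \<omega>"
  proof (cases "\<omega> \<in> characters")
    case False
    then show ?thesis
      by (simp add: spectral_action_def spectral_domain_def)
  next
    case \<omega>c: True
    have st: "star (s * t) * (s * t) = star t * (star s * s) * t"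
      by (simp add: star_mult mult.assoc)
    \<comment> \<open>The idempotent of \<open>s * t\<close> lies below \<open>star t * t\<close>,
      so both sides are undefined when \<omega> vanishes at \<open>star t * t\<close>.\<close>
    have "star t * (star s * s) * t = (star t * (star s * s) * t) * (star t * t)"
      by (simp add: mult.assoc)
    then have le: "\<omega> (star t * (star s * s) * t)
        = \<omega> (star t * (star s * s) * t) * \<omega> (star t * t)"
      using characters_mult[OF \<omega>c, of "star t * (star s * s) * t" "star t * t"] by simp
    show ?thesis
    proof (cases "\<omega> (star t * t) = 1")
      case False
      then have "\<omega> (star t * (star s * s) * t) = 0"
        using le characters_cases[OF \<omega>c, of "star t * t"] by simp
      then show ?thesis
        using False by (simp add: spectral_action_def spectral_domain_def st)
    next
      case True
      then have "\<omega> \<in> spectral_domain (star t * t)"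
        using \<omega>c by (simp add: spectral_domain_def)
      moreover have "(\<lambda>e\<in>idems. \<omega> (star (s * t) * e * (s * t)))
          = (\<lambda>e\<in>idems. (\<lambda>e\<in>idems. \<omega> (star t * e * t)) (star s * e * s))"
        by (rule restrict_ext, simp, simp add: star_mult mult.assoc)
      moreover have "(\<lambda>e\<in>idems. \<omega> (star t * e * t)) \<in> characters"
        using conj_character[of \<omega> t] calculation(1) spectral_domain_subset by blast
      ultimately show ?thesis
        using \<omega>c by (simp add: spectral_action_def spectral_domain_def st)
    qed
  qed
qed

text \<open>Every character lies in some compact open D(e), which gives local compactness and
  non-degeneracy; the basis is \<open>spectral_base\<close>.\<close>

lemma boolean_action_spectral:
  "boolean_action spectral_space (spectral_action :: 's::inverse_semigroup \<Rightarrow> _)"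
proof -
  have "locally_compact_space (spectral_space :: ('s \<Rightarrow> nat) topology)"
    unfolding locally_compact_space_def topspace_spectral_space
    using characters_nonzero openin_spectral_domain compactin_spectral_domain by blast
  then have act: "action spectral_space (spectral_action :: 's \<Rightarrow> _)"
    by (simp add: action_def Hausdorff_spectral_space spectral_action_partial_homeo
        spectral_action_mult)
  have nondeg: "nondegenerate spectral_space (spectral_action :: 's \<Rightarrow> _)"
    using characters_nonzero spectral_domain_subset
    by (fastforce simp: nondegenerate_def topspace_spectral_space dom_spectral_action_idem)
  have base: "openin (spectral_space :: ('s \<Rightarrow> nat) topology)
      = arbitrary union_of (\<lambda>K. K \<in> compact_opens spectral_space)"
  proof (subst openin_topology_base_unique, intro conjI allI impI)
    fix U :: "('s \<Rightarrow> nat) set" and \<omega>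
    assume "openin spectral_space U \<and> \<omega> \<in> U"
    then show "\<exists>B. B \<in> compact_opens spectral_space \<and> \<omega> \<in> B \<and> B \<subseteq> U"
      using spectral_base[of U \<omega>] by (auto simp: generated_gba_spectral_domain)
  qed (auto simp: compact_opens_def)
  have "(\<lambda>e. dom (spectral_action e)) ` idems = spectral_domain ` (idems :: 's set)"
    by (auto simp: dom_spectral_action_idem)
  then show ?thesis
    using act nondeg base
    by (simp add: boolean_action_def ample_action_def Hausdorff_spectral_space
        generated_gba_spectral_domain dom_spectral_action_idem spectral_domain_compact_opens)
qed

section \<open>The canonical morphism to the spectral action\<close>

definition canonical_map ::
  "'x topology \<Rightarrow> ('s::inverse_semigroup \<Rightarrow> 'x \<rightharpoonup> 'x) \<Rightarrow> 'x \<Rightarrow> 's \<Rightarrow> nat" where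
  "canonical_map X \<phi> = (\<lambda>x\<in>topspace X. \<lambda>e\<in>idems. of_bool (x \<in> dom (\<phi> e)))"

text \<open>Multiplicativity expresses that X_ef is the intersection of X_e and X_f; non-degeneracy
  makes the character non-zero.\<close>

lemma canonical_map_characters:
  assumes "ample_action X \<phi>" "x \<in> topspace X"
  shows "canonical_map X \<phi> x \<in> characters"
proof -
  have act: "action X \<phi>" and "\<exists>e\<in>idems. x \<in> dom (\<phi> e)"
    using assms by (auto simp: ample_action_def nondegenerate_def)
  then show ?thesis
    using assms(2) by (auto simp: canonical_map_def characters_def action_dom_mult_idems[OF act]
        simp del: domIff)
qed

text \<open>The coordinate at \<open>e\<close> is the indicator of X_e, which is clopen because it
  is compact and open in a Hausdorff space.\<close>

lemma continuous_map_canonical_map: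
  assumes X: "ample_action X \<phi>"
  shows "continuous_map X spectral_space (canonical_map X \<phi>)"
proof -
  have comp: "continuous_map X (discrete_topology {0, 1})
      (\<lambda>x. canonical_map X \<phi> x e)" if e: "e \<in> idems" for e
  proof -
    have K: "openin X (dom (\<phi> e))" "closedin X (dom (\<phi> e))"
      using X e compactin_imp_closedin by (auto simp: ample_action_def compact_opens_def)
    have "{x \<in> topspace X. canonical_map X \<phi> x e \<in> U}
        = (if 1 \<in> U then dom (\<phi> e) else {}) \<union> (if 0 \<in> U then topspace X - dom (\<phi> e) else {})" for U
      using e openin_subset[OF K(1)] by (auto simp: canonical_map_def simp del: domIff)
    then have "openin X {x \<in> topspace X. canonical_map X \<phi> x e \<in> U}" for U
      using K by auto
    then show ?thesis
      using e by (auto simp: continuous_map_def canonical_map_def)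
  qed
  have "continuous_map X idem_cube (canonical_map X \<phi>)"
    unfolding continuous_map_componentwise
    using comp by (auto simp: canonical_map_def)
  then show ?thesis
    using canonical_map_characters[OF X]
    by (auto simp: spectral_space_def continuous_map_in_subtopology)
qed

text \<open>Domains match because \<open>s\<close> and \<open>star s * s\<close> have the same
  domain. Equivariance says that sx lies in X_e iff x lies in the domain of
  \<open>star s * e * s\<close>.\<close>

lemma canonical_map_hom:
  assumes X: "ample_action X \<phi>"
  shows "canonical_map X \<phi> \<in> boolean_hom X \<phi> spectral_space spectral_action"
proof -
  have act: "action X \<phi>"
    using X by (simp add: ample_action_def)
  have dom: "x \<in> dom (\<phi> s) \<longleftrightarrow> canonical_map X \<phi> x \<in> dom (spectral_action s)"
    if "x \<in> topspace X" for x s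
    using that canonical_map_characters[OF X that] action_dom_star_mult[OF act, of s]
    by (simp add: dom_spectral_action spectral_domain_def canonical_map_def del: domIff)
  have "canonical_map X \<phi> (the (\<phi> s x)) = the (spectral_action s (canonical_map X \<phi> x))"
    if x: "x \<in> topspace X" and d: "x \<in> dom (\<phi> s)" for x s
  proof -
    obtain y where y: "\<phi> s x = Some y"
      using d by auto
    then have "y \<in> ran (\<phi> s)"
      by (auto simp: ran_def)
    then have yX: "y \<in> topspace X"
      using act by (auto simp: action_def partial_homeos_def dest: openin_subset)
    have "canonical_map X \<phi> x \<in> spectral_domain (star s * s)"
      using dom[OF x, of s] d by (simp add: dom_spectral_action del: domIff)
    then have "the (spectral_action s (canonical_map X \<phi> x))
        = (\<lambda>e\<in>idems. canonical_map X \<phi> x (star s * e * s))"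
      by (simp add: spectral_action_def)
    also have "\<dots> = canonical_map X \<phi> y"
      using x yX action_dom_conj[OF act _ y]
      by (auto simp: canonical_map_def fun_eq_iff simp del: domIff)
    finally show ?thesis
      using y by simp
  qed
  then have "action_morphism X \<phi> spectral_space spectral_action (canonical_map X \<phi>)"
    using dom continuous_map_canonical_map[OF X] by (simp add: action_morphism_def del: domIff)
  then show ?thesis
    by (simp add: boolean_hom_def canonical_map_def)
qed

theorem proposition4p5:
  shows
  "(\<forall>(X :: 'x topology) (\<phi> :: 's::inverse_semigroup \<Rightarrow> 'x \<rightharpoonup> 'x) (Y :: 'y topology) (\<theta> :: 's \<Rightarrow> 'y \<rightharpoonup> 'y) \<psi>.
      boolean_action X \<phi> \<longrightarrow> ample_action Y \<theta> \<longrightarrow> action_morphism X \<phi> Y \<theta> \<psi> \<longrightarrow>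
      embedding_map X Y \<psi> \<and> closedin Y (\<psi> ` topspace X)) \<and>
   (\<forall>(X :: 'x topology) (\<phi> :: 's \<Rightarrow> 'x \<rightharpoonup> 'x) (Y :: 'y topology) (\<theta> :: 's \<Rightarrow> 'y \<rightharpoonup> 'y).
      boolean_action X \<phi> \<longrightarrow> boolean_action Y \<theta> \<longrightarrow>
      (\<forall>\<alpha>\<in>boolean_hom X \<phi> Y \<theta>. \<forall>\<beta>\<in>boolean_hom X \<phi> Y \<theta>. \<alpha> = \<beta>)) \<and>
   boolean_action spectral_space (spectral_action :: 's \<Rightarrow> _) \<and>
   (\<forall>(X :: 'x topology) (\<phi> :: 's \<Rightarrow> 'x \<rightharpoonup> 'x). boolean_action X \<phi> \<longrightarrow>
      (\<exists>!\<alpha>. \<alpha> \<in> boolean_hom X \<phi> spectral_space spectral_action))"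
proof (intro conjI allI impI ballI)
  fix X :: "'x topology" and \<phi> :: "'s \<Rightarrow> 'x \<rightharpoonup> 'x"
  assume "boolean_action X \<phi>"
  then show "\<exists>!\<alpha>. \<alpha> \<in> boolean_hom X \<phi> spectral_space spectral_action"
    \<comment> \<open>Existence is the canonical map; uniqueness is the general uniqueness of
      morphisms with the spectral action as target.\<close>
    using canonical_map_hom[of X \<phi>] boolean_hom_unique[OF boolean_action_spectral]
    by (auto simp: boolean_action_def)
qed (auto intro: action_morphism_closed_embedding boolean_action_spectral boolean_hom_unique)

end
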